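(* Let $(X,d_\phi)$ be a $\phi$-metric space. Then the topological space $(X,\tau_\phi)$ is metrizable, i.e. there exists a metric on $X$ whose topology equals $\tau_\phi$.
   Context: Definition ($\phi$-metric space). Let $X$ be a nonempty set. A function $d_\phi:X\times X\to\mathbb{R}_{\ge 0}$ is a $\phi$-metric, and $(X,d_\phi)$ is a $\phi$-metric space, if there is a function $\phi:X\times X\times X\to\mathbb{R}_{\ge 0}$ such that for all $x,y,z\in X$: (d1) $d_\phi(x,y)=0$ if and only if $x=y$; (d2) $d_\phi(x,y)=d_\phi(y,x)$; (d3) $d_\phi(x,y)\le d_\phi(x,z)+d_\phi(z,y)+\phi(x,y,z)$; where $\phi$ satisfies: ($\phi1$) $\phi(x,y,z)=0$ if $x=z$ or $y=z$; ($\phi2$) $\phi(x,y,z)=\phi(y,x,z)$; ($\phi3$) for every $\epsilon>0$ there exists $\delta>0$ such that for all $x,y,z\in X$, $\phi(x,y,z)<\epsilon$ whenever $d_\phi(x,z)<\delta$ or $d_\phi(y,z)<\delta$. Open balls: $B_\phi(x,r)=\{y\in X: d_\phi(x,y)<r\}$ for $x\in X$, $r>0$. The topology of $(X,d_\phi)$ is $\tau_\phi=\{G\subseteq X:\ \forall x\in G\ \exists r>0,\ B_\phi(x,r)\subseteq G\}$ (this is a topology). *)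

theory Defs
  imports "HOL-Analysis.Abstract_Metric_Spaces"
begin

text \<open>Functions on a carrier \<open>X\<close> are represented by total functions on the ambient type, and every
  requirement is restricted to arguments in \<open>X\<close>; values elsewhere are irrelevant.\<close>

definition phi_control :: "'a set \<Rightarrow> ('a \<Rightarrow> 'a \<Rightarrow> real) \<Rightarrow> ('a \<Rightarrow> 'a \<Rightarrow> 'a \<Rightarrow> real) \<Rightarrow> bool" where
  "phi_control X d \<phi> \<longleftrightarrow>
     (\<forall>x\<in>X. \<forall>y\<in>X. \<forall>z\<in>X. 0 \<le> \<phi> x y z) \<and>
     (\<forall>x\<in>X. \<forall>y\<in>X. \<forall>z\<in>X. x = z \<or> y = z \<longrightarrow> \<phi> x y z = 0) \<and>
     (\<forall>x\<in>X. \<forall>y\<in>X. \<forall>z\<in>X. \<phi> x y z = \<phi> y x z) \<and>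
     (\<forall>\<epsilon>>0. \<exists>\<delta>>0. \<forall>x\<in>X. \<forall>y\<in>X. \<forall>z\<in>X.
        d x z < \<delta> \<or> d y z < \<delta> \<longrightarrow> \<phi> x y z < \<epsilon>)"

definition phi_metric_space :: "'a set \<Rightarrow> ('a \<Rightarrow> 'a \<Rightarrow> real) \<Rightarrow> bool" where
  "phi_metric_space X d \<longleftrightarrow>
     X \<noteq> {} \<and>
     (\<forall>x\<in>X. \<forall>y\<in>X. 0 \<le> d x y) \<and>
     (\<exists>\<phi>. phi_control X d \<phi> \<and>
        (\<forall>x\<in>X. \<forall>y\<in>X. d x y = 0 \<longleftrightarrow> x = y) \<and>
        (\<forall>x\<in>X. \<forall>y\<in>X. d x y = d y x) \<and>
        (\<forall>x\<in>X. \<forall>y\<in>X. \<forall>z\<in>X. d x y \<le> d x z + d z y + \<phi> x y z))"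

definition phi_ball :: "'a set \<Rightarrow> ('a \<Rightarrow> 'a \<Rightarrow> real) \<Rightarrow> 'a \<Rightarrow> real \<Rightarrow> 'a set" where
  "phi_ball X d x r = {y \<in> X. d x y < r}"

definition phi_topology :: "'a set \<Rightarrow> ('a \<Rightarrow> 'a \<Rightarrow> real) \<Rightarrow> 'a topology" where
  "phi_topology X d = topology (\<lambda>G. G \<subseteq> X \<and> (\<forall>x\<in>G. \<exists>r>0. phi_ball X d x r \<subseteq> G))"

lemma istopology_phi:
  "istopology (\<lambda>G. G \<subseteq> X \<and> (\<forall>x\<in>G. \<exists>r>0. phi_ball X d x r \<subseteq> G))"
  unfolding istopology_def
proof (intro conjI allI impI)
  fix S T
  assume S: "S \<subseteq> X \<and> (\<forall>x\<in>S. \<exists>r>0. phi_ball X d x r \<subseteq> S)"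
    and T: "T \<subseteq> X \<and> (\<forall>x\<in>T. \<exists>r>0. phi_ball X d x r \<subseteq> T)"
  show "S \<inter> T \<subseteq> X" using S by blast
  show "\<forall>x\<in>S \<inter> T. \<exists>r>0. phi_ball X d x r \<subseteq> S \<inter> T"
  proof
    fix x assume "x \<in> S \<inter> T"
    with S T obtain r s where "r > 0" "phi_ball X d x r \<subseteq> S" "s > 0" "phi_ball X d x s \<subseteq> T"
      by blast
    then have "min r s > 0" "phi_ball X d x (min r s) \<subseteq> S \<inter> T"
      by (auto simp: phi_ball_def)
    then show "\<exists>r>0. phi_ball X d x r \<subseteq> S \<inter> T" by blast
  qed
next
  fix \<K> assume K: "\<forall>K\<in>\<K>. K \<subseteq> X \<and> (\<forall>x\<in>K. \<exists>r>0. phi_ball X d x r \<subseteq> K)"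
  show "\<Union>\<K> \<subseteq> X" using K by blast
  show "\<forall>x\<in>\<Union>\<K>. \<exists>r>0. phi_ball X d x r \<subseteq> \<Union>\<K>"
    using K by (meson Union_iff Union_upper subset_trans)
qed

lemma openin_phi_topology:
  "openin (phi_topology X d) G \<longleftrightarrow> G \<subseteq> X \<and> (\<forall>x\<in>G. \<exists>r>0. phi_ball X d x r \<subseteq> G)"
  by (simp add: phi_topology_def topology_inverse'[OF istopology_phi])

lemma topspace_phi_topology [simp]: "topspace (phi_topology X d) = X"
proof -
  have "openin (phi_topology X d) X"
    by (auto simp: openin_phi_topology phi_ball_def intro: exI[of _ 1])
  then show ?thesis
    unfolding topspace_def by (auto simp: openin_phi_topology)
qed

text \<open>The library predicate \<^const>\<open>metrizable_space\<close> lets the carrier of the metric vary; here the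
  carrier is necessarily \<open>X\<close>.\<close>

lemma metrizable_phi_topology_iff:
  "metrizable_space (phi_topology X d) \<longleftrightarrow>
     (\<exists>\<rho>. Metric_space X \<rho> \<and> Metric_space.mtopology X \<rho> = phi_topology X d)"
  unfolding metrizable_space_def
  by (metis Metric_space.topspace_mtopology topspace_phi_topology)

end

theory Submission
  imports Defs
begin

text \<open>The control condition makes the sets \<open>{(x, y). d x y < r}\<close> the base of a uniformity: for every
  \<open>\<epsilon> > 0\<close> there is \<open>\<eta> > 0\<close> such that \<open>d x z < \<eta>\<close> and \<open>d z y < \<eta>\<close> imply \<open>d x y < \<epsilon>\<close>. Iterating this
  gives radii \<open>r n\<close> tending to \<open>0\<close> such that three steps below \<open>r (Suc n)\<close> compose to one below
  \<open>r n\<close>. Reading off the dyadic level of \<open>d x y\<close> among these radii yields a symmetric function \<open>u\<close> with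
  \<open>u x y \<le> 2 * max (u x a) (max (u a b) (u b y))\<close>, and Frink's chain lemma shows that the infimum of
  the \<open>u\<close>-lengths of chains from \<open>x\<close> to \<open>y\<close> is a metric between \<open>u / 2\<close> and \<open>u\<close>.\<close>

section \<open>Metrization from a relaxed triangle inequality\<close>

text \<open>Cut the chain at the last index \<open>k < n\<close> whose prefix weighs at most half of
  the total \<open>S\<close>. Prefix and suffix around the edge from \<open>f k\<close> to
  \<open>f (Suc k)\<close> then weigh at most \<open>S / 2\<close> each, so by induction each has
  endpoints at \<open>u\<close>-value at most \<open>S\<close>. The middle edge also weighs at most
  \<open>S\<close>, and \<open>relax\<close> with \<open>M = S\<close> joins the three.\<close>

lemma frink_chain:
  fixes u :: "'a \<Rightarrow> 'a \<Rightarrow> real" and f :: "nat \<Rightarrow> 'a"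
  assumes nonneg: "\<And>x y. \<lbrakk>x \<in> X; y \<in> X\<rbrakk> \<Longrightarrow> 0 \<le> u x y"
    and refl: "\<And>x. x \<in> X \<Longrightarrow> u x x = 0"
    and relax: "\<And>x a b y M. \<lbrakk>x \<in> X; a \<in> X; b \<in> X; y \<in> X; u x a \<le> M; u a b \<le> M; u b y \<le> M\<rbrakk>
                  \<Longrightarrow> u x y \<le> 2 * M"
    and f: "\<And>i. f i \<in> X"
    and "m \<le> n"
  shows "u (f m) (f n) \<le> 2 * (\<Sum>i=m..<n. u (f i) (f (Suc i)))"
  using \<open>m \<le> n\<close>
proof (induction "n - m" arbitrary: m n rule: less_induct)
  case less
  let ?w = "\<lambda>i. u (f i) (f (Suc i))"
  define S where "S = sum ?w {m..<n}"
  have w: "0 \<le> ?w i" for i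
    using nonneg f by blast
  show ?case
  proof (cases "m = n")
    case True
    then show ?thesis using refl f by simp
  next
    case False
    let ?P = "\<lambda>k. m \<le> k \<and> k < n \<and> sum ?w {m..<k} \<le> S / 2"
    have "S \<ge> 0"
      unfolding S_def by (intro sum_nonneg w)
    with False less.prems have "?P m" by simp
    define k where "k = Greatest ?P"
    have k: "?P k"
      unfolding k_def by (rule GreatestI_nat[where P = ?P and b = n and k = m]) (use \<open>?P m\<close> in auto)
    have max: "j \<le> k" if "?P j" for j
      unfolding k_def by (rule Greatest_le_nat[where P = ?P and b = n]) (use that in auto)
    have split: "S = sum ?w {m..<Suc k} + sum ?w {Suc k..<n}"
      unfolding S_def using k by (intro sum.atLeastLessThan_concat[symmetric]) auto
    have suffix: "sum ?w {Suc k..<n} \<le> S / 2"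
    proof (cases "Suc k = n")
      case True
      then show ?thesis using \<open>S \<ge> 0\<close> by simp
    next
      \<comment> \<open>By maximality of \<open>k\<close>, adding the edge at \<open>k\<close>
        pushes the prefix past \<open>S / 2\<close>, so less than \<open>S / 2\<close>
        remains.\<close>
      case False
      with k max[of "Suc k"] have "S / 2 < sum ?w {m..<Suc k}"
        by force
      with split show ?thesis by linarith
    qed
    have "?w k \<le> S"
      unfolding S_def using k w by (intro member_le_sum) auto
    moreover have "u (f m) (f k) \<le> S"
      using less.hyps[of k m] k by (simp add: diff_less_mono)
    moreover have "u (f (Suc k)) (f n) \<le> S"
      using less.hyps[of n "Suc k"] k suffix by (simp add: diff_less_mono2)
    ultimately show ?thesis
      using relax[OF f f f f, of m k S "Suc k" n] by (simp add: S_def)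
  qed
qed

text \<open>A chain is an infinite sequence in \<open>X\<close> cut off at \<open>n\<close>; the
  values past \<open>n\<close> do not affect the sum. Keeping all of them in \<open>X\<close> spares
  index bounds when chains are reversed or joined.\<close>

definition chain_lengths :: "'a set \<Rightarrow> ('a \<Rightarrow> 'a \<Rightarrow> real) \<Rightarrow> 'a \<Rightarrow> 'a \<Rightarrow> real set" where
  "chain_lengths X u x y =
     {(\<Sum>i<n. u (f i) (f (Suc i))) | f n. f 0 = x \<and> f n = y \<and> (\<forall>i. f i \<in> X)}"

lemma chain_lengths_singleton:
  assumes "x \<in> X" "y \<in> X"
  shows "u x y \<in> chain_lengths X u x y"
  unfolding chain_lengths_def
  by (rule CollectI, rule exI[of _ "\<lambda>i. if i = 0 then x else y"], rule exI[of _ 1])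
     (use assms in auto)

lemma chain_lengths_sym:
  assumes sym: "\<And>x y. \<lbrakk>x \<in> X; y \<in> X\<rbrakk> \<Longrightarrow> u x y = u y x"
    and "s \<in> chain_lengths X u x y"
  shows "s \<in> chain_lengths X u y x"
proof -
  obtain f n where f: "f 0 = x" "f n = y" "\<And>i. f i \<in> X"
    and s: "s = (\<Sum>i<n. u (f i) (f (Suc i)))"
    using assms(2) unfolding chain_lengths_def by blast
  \<comment> \<open>Truncated subtraction makes \<open>g\<close> constantly \<open>f 0\<close>
    beyond \<open>n\<close>, so it stays in \<open>X\<close>.\<close>
  define g where "g i = f (n - i)" for i
  have "(\<Sum>i<n. u (g i) (g (Suc i))) = (\<Sum>i<n. u (f (n - Suc i)) (f (Suc (n - Suc i))))"
    by (intro sum.cong) (auto simp: g_def Suc_diff_Suc sym f)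
  also have "\<dots> = s"
    unfolding s by (rule sum.nat_diff_reindex)
  finally have "s = (\<Sum>i<n. u (g i) (g (Suc i)))" ..
  moreover have "g 0 = y" "g n = x" "\<And>i. g i \<in> X"
    by (auto simp: g_def f)
  ultimately show ?thesis
    unfolding chain_lengths_def by blast
qed

lemma chain_lengths_add:
  assumes "s \<in> chain_lengths X u x y" "t \<in> chain_lengths X u y z"
  shows "s + t \<in> chain_lengths X u x z"
proof -
  obtain f m where f: "f 0 = x" "f m = y" "\<And>i. f i \<in> X"
    and s: "s = (\<Sum>i<m. u (f i) (f (Suc i)))"
    using assms(1) unfolding chain_lengths_def by blast
  obtain g n where g: "g 0 = y" "g n = z" "\<And>i. g i \<in> X"
    and t: "t = (\<Sum>i<n. u (g i) (g (Suc i)))"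
    using assms(2) unfolding chain_lengths_def by blast
  \<comment> \<open>Both pieces agree at the junction, \<open>f m = y = g 0\<close>, so the shift
    identity \<open>hg\<close> holds at \<open>i = 0\<close> too.\<close>
  define h where "h i = (if i \<le> m then f i else g (i - m))" for i
  have hg: "h (m + i) = g i" for i
    using f g by (auto simp: h_def)
  have "(\<Sum>i<m + n. u (h i) (h (Suc i))) =
      (\<Sum>i<m. u (h i) (h (Suc i))) + (\<Sum>i<n. u (h (m + i)) (h (m + Suc i)))"
    by (induction n) auto
  also have "(\<Sum>i<m. u (h i) (h (Suc i))) = s"
    unfolding s by (intro sum.cong) (auto simp: h_def)
  also have "(\<Sum>i<n. u (h (m + i)) (h (m + Suc i))) = t"
    unfolding hg t ..
  finally have "s + t = (\<Sum>i<m + n. u (h i) (h (Suc i)))" ..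
  moreover have "h 0 = x" "h (m + n) = z" "\<And>i. h i \<in> X"
    using f g hg by (auto simp: h_def)
  ultimately show ?thesis
    unfolding chain_lengths_def by blast
qed

text \<open>Concatenation of chains gives the triangle inequality and reversal gives symmetry. The
  danger is that the infimum collapses to 0 for distinct points; \<open>frink_chain\<close> excludes
  this.\<close>

lemma frink_metric:
  fixes u :: "'a \<Rightarrow> 'a \<Rightarrow> real"
  assumes nonneg: "\<And>x y. \<lbrakk>x \<in> X; y \<in> X\<rbrakk> \<Longrightarrow> 0 \<le> u x y"
    and zero: "\<And>x y. \<lbrakk>x \<in> X; y \<in> X\<rbrakk> \<Longrightarrow> u x y = 0 \<longleftrightarrow> x = y"
    and sym: "\<And>x y. \<lbrakk>x \<in> X; y \<in> X\<rbrakk> \<Longrightarrow> u x y = u y x"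
    and relax: "\<And>x a b y M. \<lbrakk>x \<in> X; a \<in> X; b \<in> X; y \<in> X; u x a \<le> M; u a b \<le> M; u b y \<le> M\<rbrakk>
                  \<Longrightarrow> u x y \<le> 2 * M"
  obtains \<rho> where "Metric_space X \<rho>"
    "\<And>x y. \<lbrakk>x \<in> X; y \<in> X\<rbrakk> \<Longrightarrow> \<rho> x y \<le> u x y"
    "\<And>x y. \<lbrakk>x \<in> X; y \<in> X\<rbrakk> \<Longrightarrow> u x y \<le> 2 * \<rho> x y"
proof -
  let ?L = "chain_lengths X u"
  \<comment> \<open>\<^const>\<open>Metric_space\<close> demands symmetry and nonnegativity also outside \<open>X\<close>.\<close>
  define \<rho> where "\<rho> x y = (if x \<in> X \<and> y \<in> X then Inf (?L x y) else 0)" for x y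
  have half: "u x y / 2 \<le> s" if s: "s \<in> ?L x y" for x y s
  proof -
    obtain f n where "f 0 = x" "f n = y" "\<And>i. f i \<in> X"
      and "s = (\<Sum>i<n. u (f i) (f (Suc i)))"
      using s unfolding chain_lengths_def by blast
    with frink_chain[of X u f 0 n] nonneg zero relax show ?thesis
      by (simp add: atLeast0LessThan)
  qed
  have bdd: "bdd_below (?L x y)" for x y
    using half by (rule bdd_belowI)
  have nonempty: "?L x y \<noteq> {}" if "x \<in> X" "y \<in> X" for x y
    using chain_lengths_singleton[OF that] by blast
  have upper: "\<rho> x y \<le> u x y" if "x \<in> X" "y \<in> X" for x y
    using that by (simp add: \<rho>_def cInf_lower[OF chain_lengths_singleton bdd])
  have "u x y / 2 \<le> \<rho> x y" if "x \<in> X" "y \<in> X" for x y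
    using that cInf_greatest[OF nonempty half] by (simp add: \<rho>_def)
  then have lower: "u x y \<le> 2 * \<rho> x y" if "x \<in> X" "y \<in> X" for x y
    using that by fastforce
  have "Metric_space X \<rho>"
  proof
    fix x y
    show "0 \<le> \<rho> x y"
      using lower[of x y] nonneg[of x y] by (cases "x \<in> X \<and> y \<in> X") (auto simp: \<rho>_def)
    have "?L x y = ?L y x"
      using chain_lengths_sym[of X u, OF sym] by blast
    then show "\<rho> x y = \<rho> y x"
      by (simp add: \<rho>_def)
  next
    fix x y assume xy: "x \<in> X" "y \<in> X"
    then show "\<rho> x y = 0 \<longleftrightarrow> x = y"
      using upper[OF xy] lower[OF xy] nonneg[OF xy] zero[OF xy] by auto
  next
    fix x y z assume xyz: "x \<in> X" "y \<in> X" "z \<in> X"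
    \<comment> \<open>The infimum is taken first over \<open>s\<close> with \<open>t\<close> fixed,
      then over \<open>t\<close>.\<close>
    have "Inf (?L x z) - t \<le> s" if "s \<in> ?L x y" "t \<in> ?L y z" for s t
      using cInf_lower[OF chain_lengths_add[OF that] bdd] by simp
    then have "Inf (?L x z) - t \<le> Inf (?L x y)" if "t \<in> ?L y z" for t
      using that xyz by (intro cInf_greatest nonempty)
    then have "Inf (?L x z) - Inf (?L x y) \<le> t" if "t \<in> ?L y z" for t
      using that by fastforce
    then have "Inf (?L x z) - Inf (?L x y) \<le> Inf (?L y z)"
      using xyz by (intro cInf_greatest nonempty)
    then show "\<rho> x z \<le> \<rho> x y + \<rho> y z"
      using xyz by (simp add: \<rho>_def)
  qed
  then show thesis
    using upper lower that by blast
qed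

section \<open>Radii extracted from the control condition\<close>

text \<open>Smallness of \<open>d x z\<close> forces \<open>\<phi> x y z\<close> to be small, so all
  three summands in the triangle inequality can be kept below \<open>\<epsilon> / 3\<close>.\<close>

lemma phi_metric_space_compose:
  assumes "phi_metric_space X d" "\<epsilon> > 0"
  obtains \<eta> where "\<eta> > 0"
    "\<And>x y z. \<lbrakk>x \<in> X; y \<in> X; z \<in> X; d x z < \<eta>; d z y < \<eta>\<rbrakk> \<Longrightarrow> d x y < \<epsilon>"
proof -
  obtain \<phi> where \<phi>: "phi_control X d \<phi>"
    and tri: "\<And>x y z. \<lbrakk>x \<in> X; y \<in> X; z \<in> X\<rbrakk> \<Longrightarrow> d x y \<le> d x z + d z y + \<phi> x y z"
    using assms(1) unfolding phi_metric_space_def by metis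
  have "\<epsilon> / 3 > 0" using \<open>\<epsilon> > 0\<close> by simp
  then obtain \<delta> where "\<delta> > 0"
    and small: "\<And>x y z. \<lbrakk>x \<in> X; y \<in> X; z \<in> X; d x z < \<delta>\<rbrakk> \<Longrightarrow> \<phi> x y z < \<epsilon> / 3"
    using \<phi> unfolding phi_control_def by meson
  show thesis
  proof (rule that[of "min \<delta> (\<epsilon> / 3)"])
    fix x y z assume "x \<in> X" "y \<in> X" "z \<in> X" "d x z < min \<delta> (\<epsilon> / 3)" "d z y < min \<delta> (\<epsilon> / 3)"
    with tri[of x y z] small[of x y z] show "d x y < \<epsilon>" by simp
  qed (use \<open>\<delta> > 0\<close> \<open>\<epsilon> > 0\<close> in simp)
qed

lemma phi_metric_space_radii:
  assumes "phi_metric_space X d"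
  obtains r :: "nat \<Rightarrow> real" where "\<And>n. r n > 0" "decseq r" "r \<longlonglongrightarrow> 0"
    "\<And>n x a b y. \<lbrakk>x \<in> X; a \<in> X; b \<in> X; y \<in> X; d x a < r (Suc n); d a b < r (Suc n);
       d b y < r (Suc n)\<rbrakk> \<Longrightarrow> d x y < r n"
proof -
  \<comment> \<open>The halving conjunct makes the radii decrease geometrically to 0.\<close>
  let ?Q = "\<lambda>s t. t \<le> s / 2 \<and> (\<forall>x\<in>X. \<forall>a\<in>X. \<forall>b\<in>X. \<forall>y\<in>X.
      d x a < t \<longrightarrow> d a b < t \<longrightarrow> d b y < t \<longrightarrow> d x y < s)"
  have step: "\<exists>t>0. ?Q s t" if "s > 0" for s
  proof -
    obtain p where p: "p > 0"
      "\<And>x y z. \<lbrakk>x \<in> X; y \<in> X; z \<in> X; d x z < p; d z y < p\<rbrakk> \<Longrightarrow> d x y < s"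
      using phi_metric_space_compose[OF assms \<open>s > 0\<close>] by metis
    obtain q where q: "q > 0"
      "\<And>x y z. \<lbrakk>x \<in> X; y \<in> X; z \<in> X; d x z < q; d z y < q\<rbrakk> \<Longrightarrow> d x y < p"
      using phi_metric_space_compose[OF assms \<open>p > 0\<close>] by metis
    let ?t = "min (s / 2) (min p q)"
    have "d x y < s" if "x \<in> X" "a \<in> X" "b \<in> X" "y \<in> X" "d x a < ?t" "d a b < ?t" "d b y < ?t"
      for x a b y
      \<comment> \<open>Two compositions handle three steps: \<open>x\<close>, \<open>a\<close>,
        \<open>b\<close> within \<open>q\<close> give \<open>d x b < p\<close>, and then
        \<open>b\<close> is the midpoint between \<open>x\<close> and \<open>y\<close>.\<close>
      using that p(2)[of x y b] q(2)[of x b a] by simp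
    moreover have "?t > 0" using p q \<open>s > 0\<close> by simp
    ultimately show ?thesis
      by (intro exI[of _ ?t]) auto
  qed
  have "\<exists>r. \<forall>n. r n > 0 \<and> ?Q (r n) (r (Suc n))"
    by (rule dependent_nat_choice) (use step zero_less_one in blast)+
  then obtain r where pos: "\<And>n. r n > 0" and Q: "\<And>n. ?Q (r n) (r (Suc n))"
    by blast
  have "r (Suc n) \<le> r n" for n
    using Q[of n] pos[of n] by linarith
  then have "decseq r" by (rule decseq_SucI)
  have "r n \<le> r 0 * (1 / 2) ^ n" for n
  proof (induction n)
    case (Suc n)
    with Q[of n] show ?case by simp
  qed simp
  moreover have "(\<lambda>n. r 0 * (1 / 2) ^ n) \<longlonglongrightarrow> 0"
    by (intro tendsto_mult_right_zero LIMSEQ_power_zero) simp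
  ultimately have "r \<longlonglongrightarrow> 0"
    using less_imp_le[OF pos]
    by (intro tendsto_sandwich[of "\<lambda>_. 0" r _ "\<lambda>n. r 0 * (1 / 2) ^ n"]) auto
  show thesis
    using Q by (intro that[of r] pos \<open>decseq r\<close> \<open>r \<longlonglongrightarrow> 0\<close>) blast
qed

section \<open>The dyadic level function and the comparison of topologies\<close>

text \<open>It suffices to test dyadic thresholds because \<open>v\<close> is one itself, or is 0,
  where \<open>n\<close> tends to infinity.\<close>

lemma dyadic_le_two_mult:
  assumes level: "\<And>n. v \<le> (1 / 2) ^ n \<Longrightarrow> w \<le> 2 * (1 / 2 :: real) ^ n"
    and dyadic: "v = 0 \<or> (\<exists>n. v = (1 / 2) ^ n)"
  shows "w \<le> 2 * v"
proof (cases "v = 0")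
  case True
  have "(\<lambda>n. 2 * (1 / 2 :: real) ^ n) \<longlonglongrightarrow> 0"
    by (intro tendsto_mult_right_zero LIMSEQ_power_zero) simp
  moreover have "w \<le> 2 * (1 / 2) ^ n" for n
    using level[of n] True by simp
  ultimately show ?thesis
    using True LIMSEQ_le_const[of "\<lambda>n. 2 * (1 / 2) ^ n" 0 w] by simp
next
  case False
  then show ?thesis using dyadic level by auto
qed

theorem corollary3p23:
  fixes X :: "'a set" and d :: "'a \<Rightarrow> 'a \<Rightarrow> real"
  assumes "phi_metric_space X d"
  shows "metrizable_space (phi_topology X d)"
proof -
  have d_nonneg: "0 \<le> d x y" and d_zero: "d x y = 0 \<longleftrightarrow> x = y" and d_sym: "d x y = d y x"
    if "x \<in> X" "y \<in> X" for x y
    using assms that by (auto simp: phi_metric_space_def)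
  obtain r :: "nat \<Rightarrow> real" where r_pos: "\<And>n. r n > 0" and "decseq r" and "r \<longlonglongrightarrow> 0"
    and r_step: "\<And>n x a b y. \<lbrakk>x \<in> X; a \<in> X; b \<in> X; y \<in> X; d x a < r (Suc n);
       d a b < r (Suc n); d b y < r (Suc n)\<rbrakk> \<Longrightarrow> d x y < r n"
    by (rule phi_metric_space_radii[OF assms]) (rule that)
  have below: "\<exists>n. r n < e" if "e > 0" for e
    using order_tendstoD(2)[OF \<open>r \<longlonglongrightarrow> 0\<close> that] by (auto simp: eventually_sequentially)
  \<comment> \<open>For \<open>x \<noteq> y\<close> this counts the radii exceeding
    \<open>d x y\<close>. For \<open>x = y\<close> no index qualifies, so \<open>u\<close> treats
    the diagonal separately.\<close>
  define N where "N x y = (LEAST n. r n \<le> d x y)" for x y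
  define u where "u x y = (if x = y then 0 else (1 / 2 :: real) ^ N x y)" for x y
  have N_iff: "d x y < r n \<longleftrightarrow> n < N x y" if "x \<in> X" "y \<in> X" "x \<noteq> y" for x y n
  proof -
    have "d x y > 0"
      using that d_nonneg[of x y] d_zero[of x y] by simp
    then obtain k where "r k \<le> d x y"
      using below less_imp_le by blast
    then have "r (N x y) \<le> d x y"
      unfolding N_def by (rule LeastI)
    then have "r n \<le> d x y" if "N x y \<le> n"
      using decseqD[OF \<open>decseq r\<close> that] by simp
    moreover have "\<not> r n \<le> d x y" if "n < N x y"
      using that unfolding N_def by (rule not_less_Least)
    ultimately show ?thesis
      by (meson not_le)
  qed
  have u_less: "u x y < (1 / 2) ^ n \<longleftrightarrow> d x y < r n" if "x \<in> X" "y \<in> X" for x y n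
    using that d_zero[of x x] r_pos by (cases "x = y") (auto simp: u_def N_iff)
  \<comment> \<open>The non-strict bound means \<open>n \<le> N x y\<close> off the diagonal, hence
    only radii of index below \<open>n\<close> appear.\<close>
  have u_le: "u x y \<le> (1 / 2) ^ n \<longleftrightarrow> (\<forall>k<n. d x y < r k)" if "x \<in> X" "y \<in> X" for x y n
  proof (cases "x = y")
    case True
    then show ?thesis using that d_zero[of x x] r_pos by (simp add: u_def)
  next
    case False
    have "n \<le> N x y \<longleftrightarrow> (\<forall>k<n. k < N x y)"
      by (meson leI less_irrefl order_less_le_trans)
    then show ?thesis using that False by (simp add: u_def N_iff)
  qed
  have relax: "u x y \<le> 2 * M"
    if X: "x \<in> X" "a \<in> X" "b \<in> X" "y \<in> X" and M: "u x a \<le> M" "u a b \<le> M" "u b y \<le> M" for x a b y M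
  proof -
    \<comment> \<open>\<open>M\<close> is an arbitrary real; the maximum of the three values is 0 or
      a power of \<open>1 / 2\<close>, so levels can be compared.\<close>
    define v where "v = max (u x a) (max (u a b) (u b y))"
    have "u x y \<le> 2 * (1 / 2) ^ n" if "v \<le> (1 / 2) ^ n" for n
    proof (cases n)
      case 0
      have "u x y \<le> 1" by (simp add: u_def power_le_one)
      then show ?thesis using 0 by simp
    next
      case (Suc j)
      have "u x a \<le> (1 / 2) ^ n" "u a b \<le> (1 / 2) ^ n" "u b y \<le> (1 / 2) ^ n"
        using that by (simp_all add: v_def)
      \<comment> \<open>All three steps lie below \<open>r (Suc k)\<close> since
        \<open>Suc k < n\<close>. Composing them costs one level, which is the factor 2.\<close>
      then have "d x y < r k" if "k < j" for k
        using X Suc that unfolding u_le[OF X(1,2)] u_le[OF X(2,3)] u_le[OF X(3,4)]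
        by (intro r_step[of x a b y]) auto
      then have "u x y \<le> (1 / 2) ^ j"
        using X by (simp add: u_le)
      then show ?thesis using Suc by simp
    qed
    moreover have "v = 0 \<or> (\<exists>n. v = (1 / 2) ^ n)"
      unfolding v_def max_def by (auto simp: u_def)
    ultimately have "u x y \<le> 2 * v"
      by (rule dyadic_le_two_mult)
    also have "v \<le> M" using M by (simp add: v_def)
    finally show ?thesis by simp
  qed
  obtain \<rho> where "Metric_space X \<rho>"
    and upper: "\<And>x y. \<lbrakk>x \<in> X; y \<in> X\<rbrakk> \<Longrightarrow> \<rho> x y \<le> u x y"
    and lower: "\<And>x y. \<lbrakk>x \<in> X; y \<in> X\<rbrakk> \<Longrightarrow> u x y \<le> 2 * \<rho> x y"
  proof (rule frink_metric[of X u])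
    fix x y assume "x \<in> X" "y \<in> X"
    then show "u x y = u y x"
      by (simp add: u_def N_def d_sym)
  next
    fix x a b y M
    assume "x \<in> X" "a \<in> X" "b \<in> X" "y \<in> X" "u x a \<le> M" "u a b \<le> M" "u b y \<le> M"
    then show "u x y \<le> 2 * M" by (rule relax)
  qed (simp_all add: u_def)
  then interpret Metric_space X \<rho> by simp
  have "\<exists>e>0. mball x e \<subseteq> phi_ball X d x s" if "x \<in> X" "s > 0" for x s
  proof -
    obtain n where n: "r n < s" using below \<open>s > 0\<close> by blast
    \<comment> \<open>The extra halving absorbs the factor 2 in \<open>lower\<close>.\<close>
    have "y \<in> phi_ball X d x s" if "y \<in> mball x ((1 / 2) ^ Suc n)" for y
    proof -
      have "u x y < (1 / 2) ^ n"
        using that lower[of x y] by simp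
      then show ?thesis
        using that n u_less[of x y n] by (simp add: phi_ball_def)
    qed
    then show ?thesis
      by (intro exI[of _ "(1 / 2) ^ Suc n"]) auto
  qed
  moreover have "\<exists>s>0. phi_ball X d x s \<subseteq> mball x e" if "x \<in> X" "e > 0" for x e
  proof -
    obtain n where n: "(1 / 2) ^ n < e"
      using real_arch_pow_inv[OF \<open>e > 0\<close>, of "1 / 2"] by auto
    have "y \<in> mball x e" if "y \<in> phi_ball X d x (r n)" for y
      using that n \<open>x \<in> X\<close> u_less[of x y n] upper[of x y] by (simp add: phi_ball_def)
    then show ?thesis
      using r_pos by blast
  qed
  \<comment> \<open>Each kind of ball contains one of the other kind with the same center, so both
    define the same open sets.\<close>
  ultimately have "(\<exists>e>0. mball x e \<subseteq> G) \<longleftrightarrow> (\<exists>s>0. phi_ball X d x s \<subseteq> G)" if "x \<in> X" for x G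
    using that by (meson subset_trans)
  then have "openin mtopology G \<longleftrightarrow> openin (phi_topology X d) G" for G
    unfolding openin_mtopology openin_phi_topology by (metis subsetD)
  then have "mtopology = phi_topology X d"
    by (simp add: topology_eq)
  then show ?thesis
    using metrizable_space_mtopology by metis
qed

end
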